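(* For every set of events $cs$ and all relations $P, Q$: $P\bowtie_I^{cs}Q = Q\bowtie_I^{cs}P$. Moreover, for independent lenses $ns_1\bowtie ns_2$: $P\bowtie_F^{ns_1,cs,ns_2}Q = Q\bowtie_F^{ns_2,cs,ns_1}P$.
   Context: UTP setting: relations are predicates over undashed (initial) and dashed (final) variables; $;$ is relational composition. Observational variables include traces $tr,tr'$ (finite event sequences; $-$ removal of a prefix), state $st,st'\in\Sigma$, and refusal sets $ref,ref'$; $tt$ abbreviates $tr'-tr$. Lenses: a lens $X:V\Rightarrow\Sigma$ is a pair $get_X:\Sigma\to V$, $put_X:\Sigma\to V\to\Sigma$ with $get(put\,s\,v)=v$, $put(put\,s\,v')\,v=put\,s\,v$, $put\,s\,(get\,s)=s$. $X\bowtie Y$ (independence) iff $put_X(put_Y\,s\,v)\,u = put_Y(put_X\,s\,u)\,v$ for all $s,u,v$. Override $s_1\oplus_X s_2 = put_X\,s_1\,(get_X\,s_2)$. $\mathbf{0}$ is the lens with a singleton view ($put\,s\,v=s$). Parallel-by-merge: $P\parallel_M Q = (P_0\wedge Q_1\wedge v'=v);M$, where $v$ is the tuple of all variables, $P_0$ ($Q_1$) is $P$ ($Q$) with each dashed variable $x'$ renamed to $0.x$ ($1.x$), and $M$ relates initial variables $x,0.x,1.x$ to final variables $x'$. Trace merge $\parallel_{cs}$: least function from pairs of event sequences to sets of sequences with $\langle\rangle\parallel_{cs}\langle\rangle=\{\langle\rangle\}$; $(e{:}u)\parallel_{cs}\langle\rangle$ and $\langle\rangle\parallel_{cs}(e{:}u)$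 equal $\{\langle\rangle\}$ if $e\in cs$, otherwise $\{\langle e\rangle\}{}^\frown(u\parallel_{cs}\langle\rangle)$, resp. $\{\langle e\rangle\}{}^\frown(\langle\rangle\parallel_{cs}u)$; $(e{:}u_1)\parallel_{cs}(e{:}u_2)=\{\langle e\rangle\}{}^\frown(u_1\parallel_{cs}u_2)$ if $e\in cs$, else $\{\langle e\rangle\}{}^\frown(u_1\parallel_{cs}(e{:}u_2)\cup(e{:}u_1)\parallel_{cs}u_2)$; for $e_1\ne e_2$: $\{\langle\rangle\}$ if both in $cs$, $\{\langle e_2\rangle\}{}^\frown((e_1{:}u_1)\parallel_{cs}u_2)$ if only $e_1\in cs$, $\{\langle e_1\rangle\}{}^\frown(u_1\parallel_{cs}(e_2{:}u_2))$ if only $e_2\in cs$, and the union of these two if neither. $S{}^\frown T=\{a{}^\frown b\mid a\in S,b\in T\}$; $u\restriction cs$ is the subsequence of elements of $u$ in $cs$. Inner merge: $N(ns_1,cs,ns_2) = (tt\in0.tt\parallel_{cs}1.tt\wedge 0.tt\restriction cs = 1.tt\restriction cs\wedge ref'\subseteq((0.ref\cup1.ref)\cap cs)\cup((0.ref\cap1.ref)\setminus cs)\wedge st' = (st\oplus_{ns_1}0.st)\oplus_{ns_2}1.st)$ with $0.tt = 0.tr-tr$, $1.tt = 1.tr-tr$. $N_I = N(\mathbf{0},cs,\mathbf{0})$; $P\bowtie_I^{cs}Q = P\parallel_{\exists st'\bullet N_I}Q$; $P\bowtie_F^{ns_1,cs,ns_2}Q = P\parallel_{\exists ref'\bullet N(ns_1,cs,ns_2)}Q$.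 *)

theory Defs
  imports Main "HOL-Library.Sublist"
begin

section \<open>Lenses\<close>

record ('v, 's) lens =
  lget :: "'s \<Rightarrow> 'v"
  lput :: "'s \<Rightarrow> 'v \<Rightarrow> 's"

definition is_lens :: "('v, 's) lens \<Rightarrow> bool" where
  "is_lens X \<longleftrightarrow>
     (\<forall>s v. lget X (lput X s v) = v) \<and>
     (\<forall>s v v'. lput X (lput X s v') v = lput X s v) \<and>
     (\<forall>s. lput X s (lget X s) = s)"

definition lens_indep :: "('v, 's) lens \<Rightarrow> ('w, 's) lens \<Rightarrow> bool"  (infix "\<bowtie>" 50) where
  "X \<bowtie> Y \<longleftrightarrow> (\<forall>s u v. lput X (lput Y s v) u = lput Y (lput X s u) v)"

definition lens_override :: "'s \<Rightarrow> ('v, 's) lens \<Rightarrow> 's \<Rightarrow> 's"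
    ("(_ \<oplus>\<^bsub>_\<^esub> _)" [65, 0, 66] 65) where
  "s1 \<oplus>\<^bsub>X\<^esub> s2 = lput X s1 (lget X s2)"

definition zero_lens :: "(unit, 's) lens"  ("\<zero>\<^sub>L") where
  "\<zero>\<^sub>L = \<lparr>lget = \<lambda>s. (), lput = \<lambda>s v. s\<rparr>"

section \<open>Observations and parallel-by-merge\<close>

text \<open>Any further observational variables live in the record extension,
  on which the merge predicates below impose no constraint.\<close>

record ('e, 's) obs =
  tr :: "'e list"
  st :: 's
  ref :: "'e set"

type_synonym 'a relation = "('a \<times> 'a) set"

text \<open>A merge predicate relates a triple, holding the initial variables \<open>x\<close> and
  the indexed copies \<open>0.x\<close> and \<open>1.x\<close>, to the final variables \<open>x'\<close>.\<close>

record 'a merge_state =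
  mprior :: 'a
  mleft :: 'a
  mright :: 'a

type_synonym 'a merge_pred = "('a merge_state \<times> 'a) set"

definition index0 :: "'a relation \<Rightarrow> ('a \<times> 'a merge_state) set" where
  "index0 P = {(v, m). (v, mleft m) \<in> P}"

definition index1 :: "'a relation \<Rightarrow> ('a \<times> 'a merge_state) set" where
  "index1 Q = {(v, m). (v, mright m) \<in> Q}"

definition par_by_merge :: "'a relation \<Rightarrow> 'a merge_pred \<Rightarrow> 'a relation \<Rightarrow> 'a relation"
    ("(_ \<parallel>\<^bsub>_\<^esub> _)" [85, 0, 86] 85) where
  "P \<parallel>\<^bsub>M\<^esub> Q = (index0 P \<inter> index1 Q \<inter> {(v, m). mprior m = v}) O M"

section \<open>Trace merge\<close>

definition seqs_append :: "'e list set \<Rightarrow> 'e list set \<Rightarrow> 'e list set"  (infixr "\<frown>" 75) where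
  "S \<frown> T = {a @ b | a b. a \<in> S \<and> b \<in> T}"

text \<open>The defining equations are terminating and exhaustive, so they have exactly one
  solution, which is therefore also the least one.\<close>

fun trace_merge :: "'e list \<Rightarrow> 'e set \<Rightarrow> 'e list \<Rightarrow> 'e list set" where
  "trace_merge [] cs [] = {[]}"
| "trace_merge (e # u) cs [] = (if e \<in> cs then {[]} else {[e]} \<frown> trace_merge u cs [])"
| "trace_merge [] cs (e # u) = (if e \<in> cs then {[]} else {[e]} \<frown> trace_merge [] cs u)"
| "trace_merge (e1 # u1) cs (e2 # u2) =
    (if e1 = e2 then
       if e1 \<in> cs then {[e1]} \<frown> trace_merge u1 cs u2
       else {[e1]} \<frown> (trace_merge u1 cs (e2 # u2) \<union> trace_merge (e1 # u1) cs u2)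
     else
       if e1 \<in> cs \<and> e2 \<in> cs then {[]}
       else if e1 \<in> cs then {[e2]} \<frown> trace_merge (e1 # u1) cs u2
       else if e2 \<in> cs then {[e1]} \<frown> trace_merge u1 cs (e2 # u2)
       else {[e2]} \<frown> trace_merge (e1 # u1) cs u2 \<union> {[e1]} \<frown> trace_merge u1 cs (e2 # u2))"

definition restrict_seq :: "'e list \<Rightarrow> 'e set \<Rightarrow> 'e list" where
  "restrict_seq u cs = filter (\<lambda>e. e \<in> cs) u"

text \<open>Removal of a prefix is totalised as usual in trace algebra: the result is the
  empty trace if the second argument is not a prefix of the first.\<close>

definition trace_minus :: "'e list \<Rightarrow> 'e list \<Rightarrow> 'e list" where
  "trace_minus t u = (if prefix u t then drop (length u) t else [])"

section \<open>Merge predicates\<close>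

definition inner_merge ::
  "('v, 's) lens \<Rightarrow> 'e set \<Rightarrow> ('w, 's) lens \<Rightarrow> ('e, 's, 'r) obs_scheme merge_pred" where
  "inner_merge ns1 cs ns2 =
    {(m, v').
       (let v = mprior m; v0 = mleft m; v1 = mright m;
            tt = trace_minus (tr v') (tr v);
            tt0 = trace_minus (tr v0) (tr v);
            tt1 = trace_minus (tr v1) (tr v)
        in tt \<in> trace_merge tt0 cs tt1 \<and>
           restrict_seq tt0 cs = restrict_seq tt1 cs \<and>
           ref v' \<subseteq> ((ref v0 \<union> ref v1) \<inter> cs) \<union> ((ref v0 \<inter> ref v1) - cs) \<and>
           st v' = (st v \<oplus>\<^bsub>ns1\<^esub> st v0) \<oplus>\<^bsub>ns2\<^esub> st v1)}"

definition ex_st' :: "('e, 's, 'r) obs_scheme merge_pred \<Rightarrow> ('e, 's, 'r) obs_scheme merge_pred" where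
  "ex_st' M = {(m, v'). \<exists>s. (m, v'\<lparr>st := s\<rparr>) \<in> M}"

definition ex_ref' :: "('e, 's, 'r) obs_scheme merge_pred \<Rightarrow> ('e, 's, 'r) obs_scheme merge_pred" where
  "ex_ref' M = {(m, v'). \<exists>r. (m, v'\<lparr>ref := r\<rparr>) \<in> M}"

definition inner_merge_I :: "'e set \<Rightarrow> ('e, 's, 'r) obs_scheme merge_pred" where
  "inner_merge_I cs = inner_merge \<zero>\<^sub>L cs \<zero>\<^sub>L"

definition merge_I ::
  "('e, 's, 'r) obs_scheme relation \<Rightarrow> 'e set \<Rightarrow> ('e, 's, 'r) obs_scheme relation
    \<Rightarrow> ('e, 's, 'r) obs_scheme relation"
    ("(_ \<bowtie>\<^sub>I\<^bsup>_\<^esup> _)" [85, 0, 86] 85) where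
  "P \<bowtie>\<^sub>I\<^bsup>cs\<^esup> Q = P \<parallel>\<^bsub>ex_st' (inner_merge_I cs)\<^esub> Q"

definition merge_F ::
  "('e, 's, 'r) obs_scheme relation \<Rightarrow> ('v, 's) lens \<Rightarrow> 'e set \<Rightarrow> ('w, 's) lens
    \<Rightarrow> ('e, 's, 'r) obs_scheme relation \<Rightarrow> ('e, 's, 'r) obs_scheme relation"
    ("(_ \<bowtie>\<^sub>F\<^bsup>_,_,_\<^esup> _)" [85, 0, 0, 0, 86] 85) where
  "P \<bowtie>\<^sub>F\<^bsup>ns1,cs,ns2\<^esup> Q = P \<parallel>\<^bsub>ex_ref' (inner_merge ns1 cs ns2)\<^esub> Q"

end

theory Submission
  imports Defs
begin

text \<open>Exchanging the operands of a parallel composition amounts to exchanging the indexed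
  copies \<open>mleft\<close> and \<open>mright\<close> that the merge predicate reads
  (\<open>par_by_merge_swap\<close>). It remains to see that \<open>inner_merge\<close> survives
  this exchange once its lenses are exchanged too (\<open>inner_merge_swap\<close>): trace merge is
  commutative, the refusal bound and the synchronisation condition are symmetric, and writes through
  independent lenses commute.\<close>

definition swap_merge :: "'a merge_state \<Rightarrow> 'a merge_state" where
  "swap_merge m = \<lparr>mprior = mprior m, mleft = mright m, mright = mleft m\<rparr>"

lemma swap_merge_simps [simp]:
  "mprior (swap_merge m) = mprior m"
  "mleft (swap_merge m) = mright m"
  "mright (swap_merge m) = mleft m"
  by (simp_all add: swap_merge_def)

text \<open>Reduces commutation of the composition to a pointwise property of the merge predicates,
  for arbitrary operands.\<close>

lemma par_by_merge_swap:
  assumes "\<And>m v. (m, v) \<in> M \<longleftrightarrow> (swap_merge m, v) \<in> M'"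
  shows "P \<parallel>\<^bsub>M\<^esub> Q = Q \<parallel>\<^bsub>M'\<^esub> P"
proof -
  have eq: "(v, v') \<in> P \<parallel>\<^bsub>M\<^esub> Q \<longleftrightarrow>
      (\<exists>m. (v, mleft m) \<in> P \<and> (v, mright m) \<in> Q \<and> mprior m = v \<and> (m, v') \<in> M)"
    for P Q M and v v' :: 'a
    by (auto simp: par_by_merge_def index0_def index1_def)
  \<comment> \<open>As an involution, the swap supplies the intermediate state in both
    directions.\<close>
  have "swap_merge (swap_merge m) = m" for m :: "'a merge_state"
    by (simp add: swap_merge_def)
  then show ?thesis
    unfolding set_eq_iff split_paired_All eq using assms by (metis swap_merge_simps)
qed

text \<open>Each defining equation is mirror-symmetric, up to the order of the two operands of a
  union.\<close>

lemma trace_merge_commute: "trace_merge u cs w = trace_merge w cs u"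
  by (induction u cs w rule: trace_merge.induct) (auto simp: Un_commute)

lemma lens_override_commute:
  "X \<bowtie> Y \<Longrightarrow> (s \<oplus>\<^bsub>X\<^esub> a) \<oplus>\<^bsub>Y\<^esub> b = (s \<oplus>\<^bsub>Y\<^esub> b) \<oplus>\<^bsub>X\<^esub> a"
  by (simp add: lens_indep_def lens_override_def)

lemma inner_merge_swap:
  assumes "ns1 \<bowtie> ns2"
  shows "(m, v) \<in> inner_merge ns1 cs ns2 \<longleftrightarrow> (swap_merge m, v) \<in> inner_merge ns2 cs ns1"
  unfolding inner_merge_def Let_def mem_Collect_eq case_prod_conv swap_merge_simps
    lens_override_commute[OF assms]
  by (metis trace_merge_commute Un_commute Int_commute)

theorem theorem36:
  fixes cs :: "'e set"
    and P Q :: "('e, 's, 'r) obs_scheme relation"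
    and ns1 :: "('v, 's) lens"
    and ns2 :: "('w, 's) lens"
  shows "P \<bowtie>\<^sub>I\<^bsup>cs\<^esup> Q = Q \<bowtie>\<^sub>I\<^bsup>cs\<^esup> P \<and>
    (is_lens ns1 \<and> is_lens ns2 \<and> ns1 \<bowtie> ns2
      \<longrightarrow> P \<bowtie>\<^sub>F\<^bsup>ns1,cs,ns2\<^esup> Q = Q \<bowtie>\<^sub>F\<^bsup>ns2,cs,ns1\<^esup> P)"
proof (intro conjI impI)
  \<comment> \<open>Writing through \<open>\<zero>\<^sub>L\<close> changes nothing, so it is
    independent of itself and the \<open>I\<close> case is an instance of
    \<open>inner_merge_swap\<close>.\<close>
  have zero: "(\<zero>\<^sub>L :: (unit, 's) lens) \<bowtie> \<zero>\<^sub>L"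
    by (simp add: lens_indep_def zero_lens_def)
  show "P \<bowtie>\<^sub>I\<^bsup>cs\<^esup> Q = Q \<bowtie>\<^sub>I\<^bsup>cs\<^esup> P"
    \<comment> \<open>The swap leaves the final observation alone, so one witness for the hidden
      final state serves both sides; likewise below for the hidden refusal set.\<close>
    unfolding merge_I_def inner_merge_I_def ex_st'_def
    by (intro par_by_merge_swap)
      (unfold mem_Collect_eq case_prod_conv, intro iff_exI inner_merge_swap zero)
next
  assume "is_lens ns1 \<and> is_lens ns2 \<and> ns1 \<bowtie> ns2"
  then have indep: "ns1 \<bowtie> ns2" by simp
  show "P \<bowtie>\<^sub>F\<^bsup>ns1,cs,ns2\<^esup> Q = Q \<bowtie>\<^sub>F\<^bsup>ns2,cs,ns1\<^esup> P"
    unfolding merge_F_def ex_ref'_def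
    by (intro par_by_merge_swap)
      (unfold mem_Collect_eq case_prod_conv, intro iff_exI inner_merge_swap indep)
qed

end
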